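(* Let $F$ be a gerechte framework of order $n$ whose regions are all rectangles and are arranged in columns, i.e. the set of columns $\{1,\dots,n\}$ can be partitioned into intervals of consecutive columns such that the set of columns occupied by each region of $F$ is exactly one of these intervals. Then $F$ is realizable.
   Context: A gerechte framework of order $n$ is a partition of the cells of an $n\times n$ array into $n$ regions, each containing $n$ cells. A region is a rectangle if it consists of all cells lying in some set of consecutive rows and some set of consecutive columns. A latin square of order $n$ is an $n\times n$ array with symbols $1,\dots,n$ in which each symbol appears exactly once in each row and once in each column. A latin square realizes a gerechte framework if, when its cells are partitioned by the framework, each region contains each symbol exactly once; a framework with such a latin square is called realizable. *)

theory Defs
  imports Main "HOL-Library.FuncSet" "HOL-Library.Disjoint_Sets"
begin

text \<open>A cell is a pair (row, column). Rows, columns and symbols are numbered from 1.\<close>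

type_synonym cell = "nat \<times> nat"

definition cells :: "nat \<Rightarrow> cell set" where
  "cells n = {1..n} \<times> {1..n}"

definition gerechte_framework :: "nat \<Rightarrow> cell set set \<Rightarrow> bool" where
  "gerechte_framework n F \<longleftrightarrow>
     partition_on (cells n) F \<and> card F = n \<and> (\<forall>R\<in>F. card R = n)"

definition consecutive :: "nat set \<Rightarrow> bool" where
  "consecutive I \<longleftrightarrow> (\<exists>a b. I = {a..b})"

definition rectangle :: "cell set \<Rightarrow> bool" where
  "rectangle R \<longleftrightarrow> (\<exists>I J. consecutive I \<and> consecutive J \<and> R = I \<times> J)"

definition columns_of :: "cell set \<Rightarrow> nat set" where
  "columns_of R = snd ` R"

definition arranged_in_columns :: "nat \<Rightarrow> cell set set \<Rightarrow> bool" where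
  "arranged_in_columns n F \<longleftrightarrow>
     (\<exists>P. partition_on {1..n} P \<and> (\<forall>J\<in>P. consecutive J) \<and> (\<forall>R\<in>F. columns_of R \<in> P))"

text \<open>Only the values of an array on \<open>cells n\<close> are relevant; it is unconstrained elsewhere.\<close>

definition latin_square :: "nat \<Rightarrow> (cell \<Rightarrow> nat) \<Rightarrow> bool" where
  "latin_square n L \<longleftrightarrow>
     L \<in> cells n \<rightarrow> {1..n} \<and>
     (\<forall>i\<in>{1..n}. \<forall>s\<in>{1..n}. \<exists>!j. j \<in> {1..n} \<and> L (i, j) = s) \<and>
     (\<forall>j\<in>{1..n}. \<forall>s\<in>{1..n}. \<exists>!i. i \<in> {1..n} \<and> L (i, j) = s)"

definition realizes :: "nat \<Rightarrow> (cell \<Rightarrow> nat) \<Rightarrow> cell set set \<Rightarrow> bool" where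
  "realizes n L F \<longleftrightarrow>
     latin_square n L \<and> (\<forall>R\<in>F. \<forall>s\<in>{1..n}. \<exists>!c. c \<in> R \<and> L c = s)"

definition realizable :: "nat \<Rightarrow> cell set set \<Rightarrow> bool" where
  "realizable n F \<longleftrightarrow> (\<exists>L. realizes n L F)"

end

theory Submission
  imports Defs
begin

text \<open>The cells are the edges of a bipartite multigraph joining the rows to the regions, which is
  \<open>n\<close>-regular, so by Hall's theorem its edges can be coloured with \<open>n\<close> symbols such that every row
  and every region sees each symbol exactly once. Let \<open>J\<close> be one of the column intervals. The \<open>n\<close>
  rows of \<open>{1..n} \<times> J\<close> are covered by \<open>card J\<close> regions, hence each symbol occurs \<open>card J\<close> times in
  it, and its cells are the edges of a \<open>card J\<close>-regular bipartite graph joining rows to symbols.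
  Colouring those edges with the columns in \<open>J\<close> tells how to permute the entries inside each row
  of the block so that all columns become latin; rows and regions keep their symbols.\<close>

section \<open>Hall's theorem and regular bipartite multigraphs\<close>

text \<open>Induction on the index set. A nonempty proper subset with exactly as many neighbours as
  elements splits the problem into two independent ones. If there is none, every nonempty proper
  subset has a neighbour to spare, so one representative can be fixed arbitrarily.\<close>

lemma hall:
  assumes "finite I" and "\<And>i. i \<in> I \<Longrightarrow> finite (N i)"
    and "\<And>X. X \<subseteq> I \<Longrightarrow> card X \<le> card (\<Union>(N ` X))"
  shows "\<exists>r. inj_on r I \<and> (\<forall>i\<in>I. r i \<in> N i)"
  using assms
proof (induction I arbitrary: N rule: finite_psubset_induct)
  case (psubset I)
  have fin: "finite (\<Union>(N ` X))" if "X \<subseteq> I" for X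
    using that psubset.hyps psubset.prems(1) by (meson finite_UN_I finite_subset subsetD)
  consider "I = {}"
    | (tight) X where "X \<subset> I" "X \<noteq> {}" "card (\<Union>(N ` X)) = card X"
    | (slack) "I \<noteq> {}" "\<And>X. X \<subset> I \<Longrightarrow> X \<noteq> {} \<Longrightarrow> card X < card (\<Union>(N ` X))"
    using psubset.prems(2) by (metis le_neq_implies_less psubset_imp_subset)
  then show ?case
  proof cases
    case 1
    then show ?thesis by simp
  next
    case tight
    let ?U = "\<Union>(N ` X)"
    have "\<exists>r. inj_on r X \<and> (\<forall>i\<in>X. r i \<in> N i)"
      using tight(1) psubset.prems by (intro psubset.IH) auto
    then obtain r where r: "inj_on r X" "\<And>i. i \<in> X \<Longrightarrow> r i \<in> N i" by blast
    have "\<exists>q. inj_on q (I - X) \<and> (\<forall>i\<in>I - X. q i \<in> N i - ?U)"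
    proof (intro psubset.IH)
      show "I - X \<subset> I" using tight by blast
      show "finite (N i - ?U)" if "i \<in> I - X" for i using that psubset.prems(1) by auto
      fix Y assume Y: "Y \<subseteq> I - X"
      have fins: "finite X" "finite Y"
        using Y tight(1) psubset.hyps by (auto intro: finite_subset)
      \<comment> \<open>Hall's condition for \<open>Y \<union> X\<close> loses at most
        \<open>card ?U\<close> when \<open>?U\<close> is removed, and by tightness this is exactly
        the surplus \<open>card X\<close>.\<close>
      have "card Y + card X = card (Y \<union> X)"
        using Y fins by (subst card_Un_disjoint) auto
      also have "\<dots> \<le> card (\<Union>(N ` (Y \<union> X)))"
        using Y tight(1) by (intro psubset.prems(2)) auto
      also have "\<Union>(N ` (Y \<union> X)) = \<Union>((\<lambda>i. N i - ?U) ` Y) \<union> ?U" by auto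
      also have "card \<dots> \<le> card (\<Union>((\<lambda>i. N i - ?U) ` Y)) + card ?U" by (rule card_Un_le)
      finally show "card Y \<le> card (\<Union>((\<lambda>i. N i - ?U) ` Y))" using tight(3) by simp
    qed
    then obtain q where q: "inj_on q (I - X)" "\<And>i. i \<in> I - X \<Longrightarrow> q i \<in> N i - ?U" by blast
    let ?s = "\<lambda>i. if i \<in> X then r i else q i"
    \<comment> \<open>\<open>r\<close> takes its values on \<open>X\<close> inside \<open>?U\<close>
      while \<open>q\<close> avoids \<open>?U\<close>, so the two can be glued.\<close>
    have "?s i \<noteq> ?s j" if "i \<in> X" "j \<in> I - X" for i j
      using r(2)[OF that(1)] q(2)[OF that(2)] that by auto
    then have "inj_on ?s I"
      using r(1) q(1) unfolding inj_on_def by (metis DiffI)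
    moreover have "\<forall>i\<in>I. ?s i \<in> N i" using r(2) q(2) by auto
    ultimately show ?thesis by blast
  next
    case slack
    obtain i where i: "i \<in> I" using slack(1) by blast
    have "card {i} \<le> card (\<Union>(N ` {i}))" using i by (intro psubset.prems(2)) auto
    then obtain x where x: "x \<in> N i" by fastforce
    have "\<exists>q. inj_on q (I - {i}) \<and> (\<forall>j\<in>I - {i}. q j \<in> N j - {x})"
    proof (intro psubset.IH)
      show "I - {i} \<subset> I" using i by blast
      show "finite (N j - {x})" if "j \<in> I - {i}" for j using that psubset.prems(1) by auto
      fix Y assume Y: "Y \<subseteq> I - {i}"
      show "card Y \<le> card (\<Union>((\<lambda>j. N j - {x}) ` Y))"
      proof (cases "Y = {}")
        case False
        \<comment> \<open>\<open>Y\<close> misses \<open>i\<close>, hence is proper, and the strict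
          inequality pays for the loss of \<open>x\<close>.\<close>
        then have "card Y < card (\<Union>(N ` Y))" using Y i by (intro slack(2)) auto
        then have "card Y \<le> card (\<Union>(N ` Y) - {x})"
          by (auto simp: card_Diff_singleton_if)
        also have "\<Union>(N ` Y) - {x} = \<Union>((\<lambda>j. N j - {x}) ` Y)" by auto
        finally show ?thesis .
      qed simp
    qed
    then obtain q where q: "inj_on q (I - {i})" "\<And>j. j \<in> I - {i} \<Longrightarrow> q j \<in> N j - {x}" by blast
    have "inj_on (q(i := x)) I"
      using q unfolding inj_on_def by (auto; metis DiffI Diff_iff singletonI singletonD)
    moreover have "\<forall>j\<in>I. (q(i := x)) j \<in> N j" using q(2) x by auto
    ultimately show ?thesis by blast
  qed
qed

lemma card_eq_sum_fibres:
  assumes "finite E" "finite X" "f ` E \<subseteq> X"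
  shows "card E = (\<Sum>a\<in>X. card {e\<in>E. f e = a})"
  using sum.group[OF assms, of "\<lambda>_. 1 :: nat"] by simp

text \<open>Hall's condition follows by counting the edges that leave a vertex set from both ends.
  Edges are abstract, with endpoint maps \<open>f\<close> and \<open>g\<close>, so parallel edges
  are allowed; the two bijections say that \<open>M\<close> meets every vertex exactly once.\<close>

lemma regular_bipartite_perfect_matching:
  assumes E: "finite E" "f ` E \<subseteq> A" "g ` E \<subseteq> B" and d: "d > 0"
    and A: "\<And>a. a \<in> A \<Longrightarrow> card {e\<in>E. f e = a} = d"
    and B: "\<And>b. b \<in> B \<Longrightarrow> card {e\<in>E. g e = b} = d"
  obtains M where "M \<subseteq> E" "bij_betw f M A" "bij_betw g M B"
proof -
  have surj: "f ` E = A" "g ` E = B"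
  proof -
    have "\<exists>e\<in>E. f e = a" if "a \<in> A" for a
      using A[OF that] d by (metis (mono_tags, lifting) card.empty empty_Collect_eq less_numeral_extra(3))
    moreover have "\<exists>e\<in>E. g e = b" if "b \<in> B" for b
      using B[OF that] d by (metis (mono_tags, lifting) card.empty empty_Collect_eq less_numeral_extra(3))
    ultimately show "f ` E = A" "g ` E = B" using E by fast+
  qed
  then have fin: "finite A" "finite B" using E(1) by auto
  let ?N = "\<lambda>a. g ` {e\<in>E. f e = a}"
  have "\<exists>r. inj_on r A \<and> (\<forall>a\<in>A. r a \<in> ?N a)"
  proof (intro hall)
    fix X assume X: "X \<subseteq> A"
    let ?EX = "{e\<in>E. f e \<in> X}" and ?Y = "\<Union>(?N ` X)"
    have Y: "?Y \<subseteq> B" using E(3) by auto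
    have fXY: "finite X" "finite ?Y" using X Y fin finite_subset by blast+
    \<comment> \<open>Exactly \<open>d\<close> edges start at each vertex of \<open>X\<close>; all
      of them end in \<open>?Y\<close>, where each vertex receives at most \<open>d\<close>.\<close>
    have "card ?EX = (\<Sum>a\<in>X. card {e\<in>?EX. f e = a})"
      using E(1) fXY by (intro card_eq_sum_fibres) auto
    also have "\<dots> = (\<Sum>a\<in>X. d)"
    proof (intro sum.cong refl)
      fix a assume a: "a \<in> X"
      then have "{e\<in>?EX. f e = a} = {e\<in>E. f e = a}" by auto
      then show "card {e\<in>?EX. f e = a} = d" using A a X by auto
    qed
    finally have 1: "card ?EX = card X * d" by simp
    have "card ?EX = (\<Sum>b\<in>?Y. card {e\<in>?EX. g e = b})"
      using E(1) fXY by (intro card_eq_sum_fibres) auto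
    also have "\<dots> \<le> (\<Sum>b\<in>?Y. d)"
    proof (intro sum_mono)
      fix b assume b: "b \<in> ?Y"
      have "card {e\<in>?EX. g e = b} \<le> card {e\<in>E. g e = b}"
        using E(1) by (intro card_mono) auto
      also have "\<dots> = d" using B b Y by blast
      finally show "card {e\<in>?EX. g e = b} \<le> d" .
    qed
    finally have 2: "card ?EX \<le> card ?Y * d" by simp
    show "card X \<le> card ?Y" using 1 2 d by simp
  qed (use fin E(1) in auto)
  then obtain r where r: "inj_on r A" "\<And>a. a \<in> A \<Longrightarrow> r a \<in> ?N a" by blast
  then have "\<forall>a\<in>A. \<exists>e\<in>E. f e = a \<and> g e = r a" by fastforce
  then obtain m where m: "\<And>a. a \<in> A \<Longrightarrow> m a \<in> E \<and> f (m a) = a \<and> g (m a) = r a" by metis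
  \<comment> \<open>Counting all edges from either side gives \<open>card A = card B\<close>, which
    makes the injection \<open>r\<close> surjective onto \<open>B\<close>.\<close>
  have "card A * d = card E" "card B * d = card E"
    using card_eq_sum_fibres[OF E(1) fin(1) E(2)] card_eq_sum_fibres[OF E(1) fin(2) E(3)] A B
    by auto
  then have "card A = card B" using d by (metis mult_right_cancel neq0_conv)
  moreover have "r ` A \<subseteq> B" using m E(3) by (metis image_subset_iff)
  ultimately have rB: "r ` A = B" using r(1) fin by (metis card_image card_subset_eq)
  show ?thesis
  proof
    show "m ` A \<subseteq> E" using m by auto
    show "bij_betw f (m ` A) A"
      using m by (intro bij_betw_byWitness[where f' = m]) auto
    have "inj_on g (m ` A)" using m r(1) by (auto simp: inj_on_def)
    moreover have "g ` m ` A = B" using m rB by (auto simp: image_image)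
    ultimately show "bij_betw g (m ` A) B" by (simp add: bij_betw_def)
  qed
qed

text \<open>Perfect matchings are peeled off one per colour, the rest staying regular. Colours form
  an arbitrary finite set because both the symbols and the columns of an interval will serve as
  colours.\<close>

lemma regular_bipartite_edge_colouring:
  assumes "finite C" and "finite E" "f ` E \<subseteq> A" "g ` E \<subseteq> B"
    and "\<And>a. a \<in> A \<Longrightarrow> card {e\<in>E. f e = a} = card C"
    and "\<And>b. b \<in> B \<Longrightarrow> card {e\<in>E. g e = b} = card C"
  shows "\<exists>c. c ` E \<subseteq> C \<and> (\<forall>s\<in>C. bij_betw f {e\<in>E. c e = s} A \<and> bij_betw g {e\<in>E. c e = s} B)"
  using assms
proof (induction C arbitrary: E rule: finite_induct)
  case empty
  then have "E = {}" by fastforce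
  then show ?case by simp
next
  case (insert t C)
  have "card (insert t C) > 0" using insert.hyps by simp
  from regular_bipartite_perfect_matching[OF insert.prems(1-3) this insert.prems(4,5)]
  obtain M where M: "M \<subseteq> E" "bij_betw f M A" "bij_betw g M B" by blast
  \<comment> \<open>Removing the matching lowers every degree by exactly one; stated for a generic
    \<open>h\<close> to cover both \<open>f\<close> and \<open>g\<close>.\<close>
  have fibre: "card {e\<in>E - M. h e = x} = card C"
    if h: "bij_betw h M X" and x: "x \<in> X" and c: "card {e\<in>E. h e = x} = card (insert t C)" for h X x
  proof -
    obtain e where e: "e \<in> M" "h e = x" using h x by (auto simp: bij_betw_def)
    then have "{e\<in>E - M. h e = x} = {e\<in>E. h e = x} - {e}"
      using h M(1) by (auto simp: bij_betw_def inj_on_def)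
    then show ?thesis using c e M(1) insert.hyps by (auto simp: card_Diff_singleton_if)
  qed
  have "\<exists>c. c ` (E - M) \<subseteq> C \<and>
      (\<forall>s\<in>C. bij_betw f {e\<in>E - M. c e = s} A \<and> bij_betw g {e\<in>E - M. c e = s} B)"
  proof (rule insert.IH)
    show "finite (E - M)" "f ` (E - M) \<subseteq> A" "g ` (E - M) \<subseteq> B" using insert.prems by auto
    show "card {e\<in>E - M. f e = a} = card C" if "a \<in> A" for a
      using fibre[OF M(2) that] insert.prems(4)[OF that] .
    show "card {e\<in>E - M. g e = b} = card C" if "b \<in> B" for b
      using fibre[OF M(3) that] insert.prems(5)[OF that] .
  qed
  then obtain c where c: "c ` (E - M) \<subseteq> C"
    "\<And>s. s \<in> C \<Longrightarrow> bij_betw f {e\<in>E - M. c e = s} A \<and> bij_betw g {e\<in>E - M. c e = s} B"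
    by blast
  let ?c = "\<lambda>e. if e \<in> M then t else c e"
  have "{e\<in>E. ?c e = t} = M" using c(1) M(1) insert.hyps by auto
  moreover have "{e\<in>E. ?c e = s} = {e\<in>E - M. c e = s}" if "s \<in> C" for s
    using that insert.hyps by auto
  ultimately have "\<forall>s\<in>insert t C. bij_betw f {e\<in>E. ?c e = s} A \<and> bij_betw g {e\<in>E. ?c e = s} B"
    using c(2) M by auto
  moreover have "?c ` E \<subseteq> insert t C" using c(1) by auto
  ultimately show ?case by blast
qed

section \<open>Realizing the framework\<close>

text \<open>Turns a matching class into the unique-existence form in which rows, columns and regions
  are later checked.\<close>

lemma bij_betw_fibres_ex1:
  assumes "bij_betw f {e\<in>E. c e = s} A" "a \<in> A"
  shows "\<exists>!e. e \<in> E \<and> f e = a \<and> c e = s"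
  using assms unfolding bij_betw_def inj_on_def image_iff by (smt (verit) image_iff mem_Collect_eq)

theorem theorem9:
  fixes n :: nat and F :: "(nat \<times> nat) set set"
  assumes "gerechte_framework n F"
    and "\<forall>R\<in>F. rectangle R"
    and "arranged_in_columns n F"
  shows "realizable n F"
proof -
  let ?N = "{1..n}" and ?E = "cells n"
  have F: "partition_on ?E F" "card F = n" "\<And>R. R \<in> F \<Longrightarrow> card R = n"
    using assms(1) by (auto simp: gerechte_framework_def)
  obtain P where P: "partition_on ?N P" "\<And>R. R \<in> F \<Longrightarrow> columns_of R \<in> P"
    using assms(3) by (auto simp: arranged_in_columns_def)
  have finE: "finite ?E" by (simp add: cells_def)
  have FE: "\<Union>F = ?E" and Fdisj: "\<And>R S. R \<in> F \<Longrightarrow> S \<in> F \<Longrightarrow> R \<inter> S \<noteq> {} \<Longrightarrow> R = S"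
    using F(1) by (auto simp: partition_on_def disjoint_def)
  have PN: "\<Union>P = ?N" and Pdisj: "\<And>J K. J \<in> P \<Longrightarrow> K \<in> P \<Longrightarrow> J \<inter> K \<noteq> {} \<Longrightarrow> J = K"
    using P(1) by (auto simp: partition_on_def disjoint_def)

  \<comment> \<open>The region of a cell and the interval of a column\<close>
  have "\<forall>e\<in>?E. \<exists>R\<in>F. e \<in> R" using FE by blast
  then obtain reg where reg: "\<And>e. e \<in> ?E \<Longrightarrow> reg e \<in> F \<and> e \<in> reg e" by metis
  have regF: "{e\<in>?E. reg e = R} = R" if "R \<in> F" for R
    using that reg FE Fdisj by blast
  have "\<forall>j\<in>?N. \<exists>J\<in>P. j \<in> J" using PN by blast
  then obtain blk where blk: "\<And>j. j \<in> ?N \<Longrightarrow> blk j \<in> P \<and> j \<in> blk j" by metis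
  have blkP: "blk j = J" if "J \<in> P" "j \<in> J" for J j
    using that blk PN Pdisj by (metis IntI UnionI empty_iff)

  \<comment> \<open>First colouring: symbols, correct on rows and regions\<close>
  have row_card: "card {e\<in>?E. fst e = i} = n" if "i \<in> ?N" for i
  proof -
    have "{e\<in>?E. fst e = i} = {i} \<times> ?N" using that by (auto simp: cells_def)
    then show ?thesis by simp
  qed
  have "\<exists>c. c ` ?E \<subseteq> ?N \<and>
      (\<forall>s\<in>?N. bij_betw fst {e\<in>?E. c e = s} ?N \<and> bij_betw reg {e\<in>?E. c e = s} F)"
  proof (rule regular_bipartite_edge_colouring)
    show "fst ` ?E \<subseteq> ?N" by (auto simp: cells_def)
    show "reg ` ?E \<subseteq> F" using reg by auto
  qed (use finE row_card regF F(3) in auto)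
  then obtain c where cN: "c ` ?E \<subseteq> ?N"
    and c_row: "\<And>s. s \<in> ?N \<Longrightarrow> bij_betw fst {e\<in>?E. c e = s} ?N"
    and c_reg: "\<And>s. s \<in> ?N \<Longrightarrow> bij_betw reg {e\<in>?E. c e = s} F"
    by blast

  \<comment> \<open>Second colouring: target columns inside each interval\<close>
  have rect: "\<exists>I. R = I \<times> J" if "R \<in> F" "columns_of R = J" for R J
  proof -
    have "rectangle R" using assms(2) that(1) by blast
    then obtain I K where R: "R = I \<times> K" unfolding rectangle_def by blast
    moreover have "R \<noteq> {}" using F(1) that(1) by (auto simp: partition_on_def)
    ultimately have "columns_of R = K" by (simp add: columns_of_def)
    then show ?thesis using R that(2) by auto
  qed
  \<comment> \<open>The columns of the region form a class of \<open>P\<close> that shares the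
    column \<open>snd e\<close> with \<open>J\<close>.\<close>
  have blk_reg: "columns_of (reg e) = J" if "e \<in> ?N \<times> J" "J \<in> P" for e J
  proof -
    have "J \<subseteq> ?N" using that(2) PN by blast
    then have "e \<in> ?E" using that by (auto simp: cells_def)
    then have "snd e \<in> columns_of (reg e)" "columns_of (reg e) \<in> P"
      using reg P(2) by (auto simp: columns_of_def)
    then show ?thesis using Pdisj that by (metis IntI SigmaE empty_iff snd_conv)
  qed

  \<comment> \<open>\<open>d e\<close> is the column to which the entry of cell \<open>e\<close>
    will move. The bijection with rows makes the move a permutation of each row of the block; the
    one with symbols makes the new columns latin.\<close>
  define column_colouring where "column_colouring J d \<longleftrightarrow> d ` (?N \<times> J) \<subseteq> J \<and>
      (\<forall>j\<in>J. bij_betw fst {e\<in>?N \<times> J. d e = j} ?N \<and> bij_betw c {e\<in>?N \<times> J. d e = j} ?N)"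
    for J and d :: "cell \<Rightarrow> nat"
  have "\<exists>d. column_colouring J d" if J: "J \<in> P" for J
    unfolding column_colouring_def
  proof (rule regular_bipartite_edge_colouring)
    have JN: "J \<subseteq> ?N" using J PN by blast
    then have sub: "?N \<times> J \<subseteq> ?E" by (auto simp: cells_def)
    show finJ: "finite J" using JN finite_subset by blast
    then show finB: "finite (?N \<times> J)" by simp
    show "fst ` (?N \<times> J) \<subseteq> ?N" by auto
    show "c ` (?N \<times> J) \<subseteq> ?N" using cN sub by blast
    show "card {e\<in>?N \<times> J. fst e = i} = card J" if "i \<in> ?N" for i
    proof -
      have "{e\<in>?N \<times> J. fst e = i} = {i} \<times> J" using that by auto
      then show ?thesis by (simp add: card_cartesian_product_singleton)
    qed
    fix s assume s: "s \<in> ?N"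
    let ?G = "{R\<in>F. columns_of R = J}"
    have regB: "reg e \<in> ?G" if "e \<in> ?N \<times> J" for e
      using that sub reg blk_reg J by auto
    have GB: "R \<subseteq> ?N \<times> J" if R: "R \<in> ?G" for R
    proof -
      obtain I where I: "R = I \<times> J" using rect R by blast
      have "R \<subseteq> ?E" using R FE by blast
      then show ?thesis using I by (auto simp: cells_def)
    qed
    have finG: "finite ?G" using F(1) finE by (simp add: finite_elements)
    \<comment> \<open>The block is tiled by the regions in \<open>?G\<close>, of \<open>n\<close>
      cells each. Cancelling \<open>n\<close> is allowed since \<open>s \<in> ?N\<close> forces
      \<open>n > 0\<close>.\<close>
    have "n * card J = card (?N \<times> J)" by (simp add: card_cartesian_product)
    also have "\<dots> = (\<Sum>R\<in>?G. card {e\<in>?N \<times> J. reg e = R})"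
      using regB by (intro card_eq_sum_fibres finB finG) auto
    also have "\<dots> = (\<Sum>R\<in>?G. n)"
    proof (intro sum.cong refl)
      fix R assume R: "R \<in> ?G"
      then have "{e\<in>?N \<times> J. reg e = R} = R"
        using GB[OF R] regF[of R] sub by blast
      then show "card {e\<in>?N \<times> J. reg e = R} = n" using F(3) R by auto
    qed
    finally have "card ?G = card J" using s by simp
    \<comment> \<open>Each region contains \<open>s\<close> once, so the occurrences of
      \<open>s\<close> in the block correspond to its regions.\<close>
    moreover have "bij_betw reg {e\<in>?N \<times> J. c e = s} ?G"
    proof (rule bij_betw_subset[OF c_reg[OF s]])
      show "reg ` {e\<in>?N \<times> J. c e = s} = ?G"
      proof
        show "reg ` {e\<in>?N \<times> J. c e = s} \<subseteq> ?G" using regB by auto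
        show "?G \<subseteq> reg ` {e\<in>?N \<times> J. c e = s}"
        proof
          fix R assume R: "R \<in> ?G"
          then obtain e where e: "e \<in> ?E" "c e = s" "reg e = R"
            using c_reg[OF s] by (auto simp: bij_betw_def image_iff)
          then have "e \<in> ?N \<times> J" using reg GB[OF R] by blast
          then show "R \<in> reg ` {e\<in>?N \<times> J. c e = s}" using e by blast
        qed
      qed
    qed (use sub in auto)
    ultimately show "card {e\<in>?N \<times> J. c e = s} = card J"
      using bij_betw_same_card by fastforce
  qed
  then obtain d where "\<And>J. J \<in> P \<Longrightarrow> column_colouring J (d J)" by metis
  then have d: "\<And>J. J \<in> P \<Longrightarrow> d J ` (?N \<times> J) \<subseteq> J"
    and d_row: "\<And>J j. J \<in> P \<Longrightarrow> j \<in> J \<Longrightarrow> bij_betw fst {e\<in>?N \<times> J. d J e = j} ?N"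
    and d_sym: "\<And>J j. J \<in> P \<Longrightarrow> j \<in> J \<Longrightarrow> bij_betw c {e\<in>?N \<times> J. d J e = j} ?N"
    unfolding column_colouring_def by blast+

  \<comment> \<open>Moving the entries within their rows\<close>
  define \<phi> where "\<phi> e = (fst e, d (blk (snd e)) e)" for e
  have \<phi>_block: "\<phi> (i, j) = (i, d J (i, j))" if "J \<in> P" "j \<in> J" for i j J
    using blkP[OF that] by (simp add: \<phi>_def)
  \<comment> \<open>Rectangles spanning a whole interval are invariant: in each row every column of
    \<open>J\<close> is a target, by \<open>d_row\<close>. This serves both for full blocks and for
    regions.\<close>
  have \<phi>_R: "bij_betw \<phi> R R" if IJ: "R = I \<times> J" "I \<subseteq> ?N" "J \<in> P" for R I J
  proof -
    have im: "\<phi> ` R = R"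
    proof
      show "\<phi> ` R \<subseteq> R" using IJ d[OF IJ(3)] by (force simp: \<phi>_block)
      show "R \<subseteq> \<phi> ` R"
      proof
        fix e assume "e \<in> R"
        then obtain i j where e: "e = (i, j)" "i \<in> I" "j \<in> J" using IJ by auto
        then obtain e' where "e' \<in> ?N \<times> J" "d J e' = j" "fst e' = i"
          using bij_betw_fibres_ex1[OF d_row[OF IJ(3)]] IJ(2) by (metis subsetD)
        then show "e \<in> \<phi> ` R" using e IJ by (intro image_eqI[of _ _ e']) (auto simp: \<phi>_block)
      qed
    qed
    have "finite J" using IJ(3) PN by (metis Union_upper finite_atLeastAtMost finite_subset)
    then have "finite R" using IJ by (auto intro: finite_subset)
    then show ?thesis using im by (simp add: bij_betw_def eq_card_imp_inj_on)
  qed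
  \<comment> \<open>The entry of \<open>e\<close> is placed at \<open>\<phi> e\<close>; injectivity
    of \<open>\<phi>\<close> makes this consistent.\<close>
  define L where "L = c \<circ> inv_into ?E \<phi>"
  have \<phi>_inj: "inj_on \<phi> ?E"
  proof (rule inj_onI)
    fix x y assume xy: "x \<in> ?E" "y \<in> ?E" "\<phi> x = \<phi> y"
    let ?J = "blk (snd x)" and ?K = "blk (snd y)"
    have J: "?J \<in> P" "x \<in> ?N \<times> ?J" and K: "?K \<in> P" "y \<in> ?N \<times> ?K"
      using xy blk by (auto simp: cells_def)
    have "snd (\<phi> x) \<in> ?J" "snd (\<phi> y) \<in> ?K"
      using d[OF J(1)] d[OF K(1)] J K by (auto simp: \<phi>_def)
    \<comment> \<open>Moves never leave their block, so a common image forces a common block, where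
      \<open>\<phi>_R\<close> applies.\<close>
    then have "?J = ?K" using Pdisj J K xy(3) by (metis IntI empty_iff)
    then have "y \<in> ?N \<times> ?J" using K by simp
    moreover have "inj_on \<phi> (?N \<times> ?J)"
      using \<phi>_R[OF refl subset_refl J(1)] by (rule bij_betw_imp_inj_on)
    ultimately show "x = y" using J(2) xy(3) by (meson inj_onD)
  qed
  have L\<phi>: "L (\<phi> e) = c e" if "e \<in> ?E" for e
    using that \<phi>_inj by (simp add: L_def)
  \<comment> \<open>On a set permuted by \<open>\<phi>\<close>, \<open>L\<close> is only a
    rearrangement of \<open>c\<close>, so properties of \<open>c\<close> on rows and regions carry
    over.\<close>
  have reg_ex1: "\<exists>!e. e \<in> R \<and> L e = s"
    if \<phi>: "bij_betw \<phi> R R" "R \<subseteq> ?E" and s: "\<exists>!e. e \<in> R \<and> c e = s" for R s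
  proof -
    obtain e where e: "e \<in> R" "c e = s" and u: "\<And>e'. e' \<in> R \<Longrightarrow> c e' = s \<Longrightarrow> e' = e"
      using s by blast
    show ?thesis
    proof (rule ex1I[of _ "\<phi> e"])
      show "\<phi> e \<in> R \<and> L (\<phi> e) = s" using e \<phi> L\<phi>[of e] by (auto simp: bij_betw_def)
      fix y assume y: "y \<in> R \<and> L y = s"
      then obtain x where x: "x \<in> R" "y = \<phi> x"
        using bij_betw_imp_surj_on[OF \<phi>(1)] by blast
      then show "y = \<phi> e" using y u[of x] \<phi>(2) L\<phi>[of x] by auto
    qed
  qed

  \<comment> \<open>Verification of rows, columns and regions\<close>
  have \<phi>_E: "\<phi> ` ?E = ?E"
  proof -
    have "?E = (\<Union>J\<in>P. ?N \<times> J)" using PN by (auto simp: cells_def)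
    moreover have "\<phi> ` (?N \<times> J) = ?N \<times> J" if "J \<in> P" for J
      using \<phi>_R[of "?N \<times> J" ?N J] that by (simp add: bij_betw_def)
    ultimately show ?thesis by (simp add: image_UN)
  qed
  have LN: "L \<in> ?E \<rightarrow> ?N"
  proof
    fix y assume "y \<in> ?E"
    then obtain x where x: "x \<in> ?E" "y = \<phi> x" using \<phi>_E by blast
    then show "L y \<in> ?N" using cN L\<phi>[of x] by auto
  qed
  have row: "\<exists>!j. j \<in> ?N \<and> L (i, j) = s" if i: "i \<in> ?N" and s: "s \<in> ?N" for i s
  proof -
    let ?R = "{i} \<times> ?N"
    have sub: "?R \<subseteq> ?E" using i by (auto simp: cells_def)
    have ex: "\<exists>!e. e \<in> ?R \<and> c e = s"
    proof -
      have "e \<in> ?R \<longleftrightarrow> e \<in> ?E \<and> fst e = i" for e using i by (auto simp: cells_def)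
      then show ?thesis using bij_betw_fibres_ex1[OF c_row[OF s] i] by simp
    qed
    have "bij_betw \<phi> ?R ?R"
    proof -
      have "\<phi> ` ?R \<subseteq> ?R" using \<phi>_E sub by (force simp: \<phi>_def cells_def)
      moreover have "inj_on \<phi> ?R" using \<phi>_inj sub by (rule inj_on_subset)
      ultimately show ?thesis
        by (simp add: bij_betw_def endo_inj_surj)
    qed
    from reg_ex1[OF this sub ex] obtain e where e: "e \<in> ?R" "L e = s"
      and u: "\<And>e'. e' \<in> ?R \<Longrightarrow> L e' = s \<Longrightarrow> e' = e"
      by blast
    show ?thesis
    proof (rule ex1I[of _ "snd e"])
      show "snd e \<in> ?N \<and> L (i, snd e) = s" using e by auto
      show "j = snd e" if "j \<in> ?N \<and> L (i, j) = s" for j using u[of "(i, j)"] that by auto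
    qed
  qed
  have col: "\<exists>!i. i \<in> ?N \<and> L (i, j) = s" if j: "j \<in> ?N" and s: "s \<in> ?N" for j s
  proof -
    define J where "J = blk j"
    have J: "J \<in> P" "j \<in> J" using blk j by (auto simp: J_def)
    then have sub: "?N \<times> J \<subseteq> ?E" using PN by (auto simp: cells_def)
    \<comment> \<open>The new column \<open>j\<close> is filled from the cells with
      \<open>d\<close>-colour \<open>j\<close>, among which each symbol occurs once.\<close>
    obtain e where e: "e \<in> ?N \<times> J" "c e = s" "d J e = j"
      and u: "\<And>e'. e' \<in> ?N \<times> J \<Longrightarrow> c e' = s \<Longrightarrow> d J e' = j \<Longrightarrow> e' = e"
      using bij_betw_fibres_ex1[OF d_sym[OF J] s] by blast
    have \<phi>e: "\<phi> x = (fst x, d J x)" if "x \<in> ?N \<times> J" for x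
      using that J(1) \<phi>_block by (metis SigmaE fst_conv)
    show ?thesis
    proof (rule ex1I[of _ "fst e"])
      show "fst e \<in> ?N \<and> L (fst e, j) = s" using e L\<phi>[of e] sub \<phi>e[of e] by auto
      fix i assume i: "i \<in> ?N \<and> L (i, j) = s"
      have "\<phi> ` (?N \<times> J) = ?N \<times> J"
        using \<phi>_R[OF refl subset_refl J(1)] by (rule bij_betw_imp_surj_on)
      then have "(i, j) \<in> \<phi> ` (?N \<times> J)" using i J(2) by simp
      then obtain x where x: "x \<in> ?N \<times> J" "\<phi> x = (i, j)" by (metis imageE)
      then have "d J x = j" "fst x = i" using \<phi>e[OF x(1)] by auto
      moreover have "c x = s" using i x(2) L\<phi>[OF subsetD[OF sub x(1)]] by simp
      ultimately show "i = fst e" using u x by blast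
    qed
  qed
  have "\<exists>!e. e \<in> R \<and> L e = s" if R: "R \<in> F" and s: "s \<in> ?N" for R s
  proof (rule reg_ex1)
    show RE: "R \<subseteq> ?E" using R FE by blast
    obtain I where I: "R = I \<times> columns_of R" using rect[OF R refl] by blast
    \<comment> \<open>With an empty second factor, \<open>R \<subseteq> ?E\<close> would say nothing
      about \<open>I\<close>.\<close>
    have "columns_of R \<noteq> {}" using P(1) P(2)[OF R] by (metis partition_onD3)
    then have "I \<subseteq> ?N" using I RE unfolding cells_def by blast
    then show "bij_betw \<phi> R R" using \<phi>_R[OF I] P(2)[OF R] by blast
    have "e \<in> R \<longleftrightarrow> e \<in> ?E \<and> reg e = R" for e using regF[OF R] by blast
    then show "\<exists>!e. e \<in> R \<and> c e = s" using bij_betw_fibres_ex1[OF c_reg[OF s] R] by simp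
  qed
  then have "realizes n L F"
    unfolding realizes_def latin_square_def using LN row col by (intro conjI ballI) assumption+
  then show ?thesis unfolding realizable_def by blast
qed

end
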